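(* Let $G=(V,E)$ be a finite DAG and fix any total order $v_1,v_2,\dots,v_n$ (from highest to lowest) of its vertices. Let $L_{out}(v),L_{in}(v)\subseteq V$ ($v\in V$) be the labels produced by the Distribution-Labeling algorithm (as defined in the context) run with this order. Then the labeling is complete: for every pair of vertices $(u,v)$ of $G$, $$u\rightarrow v\quad\text{iff}\quad L_{out}(u)\cap L_{in}(v)\neq\emptyset .$$
   Context: $u\rightarrow v$ means there is a directed path (possibly of length $0$, so $u\rightarrow u$) from $u$ to $v$ in $G$. Distribution-Labeling algorithm: initially $L_{out}(v)=L_{in}(v)=\emptyset$ for all $v\in V$. For $i=1,2,\dots,n$ in this order do the following two steps. Step 1. Perform a reverse BFS from $v_i$ (following edges backwards, starting by visiting $v_i$ itself, each vertex visited at most once). For each visited vertex $u$: if $L_{out}(u)\cap L_{in}(v_i)\neq\emptyset$, do not add $v_i$ to $L_{out}(u)$ and do not expand $u$ (its in-neighbours are not enqueued from $u$); otherwise add $v_i$ to $L_{out}(u)$ and expand $u$ (its unvisited in-neighbours are enqueued). Step 2. Then perform a forward BFS from $v_i$ (starting by visiting $v_i$ itself, each vertex visited at most once). For each visited vertex $w$: if $L_{in}(w)\cap L_{out}(v_i)\neq\emptyset$, do not add $v_i$ to $L_{in}(w)$ and do not expand $w$; otherwise add $v_i$ to $L_{in}(w)$ and expand $w$ (its unvisited out-neighbours are enqueued). The labels are always the current ones at the time of the test. *)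

theory Defs
  imports Main
begin

definition finite_dag :: "'a set \<Rightarrow> ('a \<times> 'a) set \<Rightarrow> bool" where
  "finite_dag V E \<longleftrightarrow> finite V \<and> E \<subseteq> V \<times> V \<and> acyclic E"

type_synonym 'a labels = "'a \<Rightarrow> 'a set"

(* A state is (queue, vertices already discovered, labels being written).
   R is the edge relation being followed, s the source, and H the label set of s of the
   opposite kind, which the search does not modify.  Vertices are marked when enqueued, so none
   is dequeued twice.  The order in which the new neighbours are enqueued is left open. *)
inductive bfs_step ::
  "('a \<times> 'a) set \<Rightarrow> 'a \<Rightarrow> 'a set \<Rightarrow>
   'a list \<times> 'a set \<times> 'a labels \<Rightarrow> 'a list \<times> 'a set \<times> 'a labels \<Rightarrow> bool"
  for R s H where
  prune: "L u \<inter> H \<noteq> {} \<Longrightarrow> bfs_step R s H (u # q, D, L) (q, D, L)"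
| expand: "L u \<inter> H = {} \<Longrightarrow> distinct ws \<Longrightarrow> set ws = R `` {u} - D \<Longrightarrow>
    bfs_step R s H (u # q, D, L) (q @ ws, D \<union> set ws, L(u := insert s (L u)))"

definition pruned_bfs ::
  "('a \<times> 'a) set \<Rightarrow> 'a \<Rightarrow> 'a set \<Rightarrow> 'a labels \<Rightarrow> 'a labels \<Rightarrow> bool" where
  "pruned_bfs R s H L L' \<longleftrightarrow>
    (\<exists>D. (bfs_step R s H)\<^sup>*\<^sup>* ([s], {s}, L) ([], D, L'))"

(* Label pairs are (L_out, L_in). *)
inductive dl_run ::
  "('a \<times> 'a) set \<Rightarrow> 'a list \<Rightarrow> 'a labels \<times> 'a labels \<Rightarrow> 'a labels \<times> 'a labels \<Rightarrow> bool"
  for E where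
  Nil: "dl_run E [] S S"
| Cons: "pruned_bfs (E\<inverse>) v (Lin v) Lout Lout' \<Longrightarrow>
    pruned_bfs E v (Lout' v) Lin Lin' \<Longrightarrow>
    dl_run E vs (Lout', Lin') S \<Longrightarrow>
    dl_run E (v # vs) (Lout, Lin) S"

(* Relational because of the open enqueueing order: Lout, Lin is a possible output. *)
definition distribution_labeling ::
  "('a \<times> 'a) set \<Rightarrow> 'a list \<Rightarrow> 'a labels \<Rightarrow> 'a labels \<Rightarrow> bool" where
  "distribution_labeling E vs Lout Lin \<longleftrightarrow>
    dl_run E vs (\<lambda>_. {}, \<lambda>_. {}) (Lout, Lin)"

(* The algorithm always has an output, so assuming distribution_labeling is not vacuous. *)

lemma bfs_terminates:
  assumes "finite V" "R \<subseteq> V \<times> V"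
  shows "\<exists>D' L'. (bfs_step R s H)\<^sup>*\<^sup>* (q, D, L) ([], D', L')"
proof (induction "card (V - D) + length q" arbitrary: q D L rule: less_induct)
  case less
  show ?case
  proof (cases q)
    case Nil
    then show ?thesis by blast
  next
    case (Cons u r)
    show ?thesis
    proof (cases "L u \<inter> H = {}")
      case False
      then have "bfs_step R s H (q, D, L) (r, D, L)"
        unfolding Cons by (rule bfs_step.prune)
      moreover have "\<exists>D' L'. (bfs_step R s H)\<^sup>*\<^sup>* (r, D, L) ([], D', L')"
        by (rule less) (simp add: Cons)
      ultimately show ?thesis by (meson converse_rtranclp_into_rtranclp)
    next
      case True
      have sub: "R `` {u} - D \<subseteq> V - D" using assms(2) by auto
      then have "finite (R `` {u} - D)" using assms(1) by (meson finite_Diff finite_subset)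
      then obtain ws where ws: "distinct ws" "set ws = R `` {u} - D"
        using finite_distinct_list by blast
      let ?L = "L(u := insert s (L u))"
      have step: "bfs_step R s H (q, D, L) (r @ ws, D \<union> set ws, ?L)"
        unfolding Cons using True ws by (rule bfs_step.expand)
      have "V - (D \<union> set ws) = (V - D) - set ws" by auto
      then have "card (V - (D \<union> set ws)) = card (V - D) - length ws"
        using sub ws by (metis card_Diff_subset distinct_card finite_set)
      moreover have "length ws \<le> card (V - D)"
        using sub ws assms(1) by (metis card_mono distinct_card finite_Diff)
      ultimately have "\<exists>D' L'. (bfs_step R s H)\<^sup>*\<^sup>* (r @ ws, D \<union> set ws, ?L) ([], D', L')"
        by (intro less) (simp add: Cons)
      with step show ?thesis by (meson converse_rtranclp_into_rtranclp)
    qed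
  qed
qed

lemma distribution_labeling_exists:
  assumes "finite_dag V E"
  shows "\<exists>Lout Lin. distribution_labeling E vs Lout Lin"
proof -
  have "finite V" "E \<subseteq> V \<times> V" "E\<inverse> \<subseteq> V \<times> V"
    using assms by (auto simp: finite_dag_def)
  then have bfs: "\<exists>L'. pruned_bfs E v H L L'" "\<exists>L'. pruned_bfs (E\<inverse>) v H L L'" for v H L
    unfolding pruned_bfs_def by (metis bfs_terminates)+
  have "\<exists>S'. dl_run E vs S S'" for S
  proof (induction vs arbitrary: S)
    case Nil
    show ?case by (blast intro: dl_run.Nil)
  next
    case (Cons v vs)
    obtain Lout Lin where "S = (Lout, Lin)" by (cases S)
    with Cons bfs show ?case by (metis dl_run.Cons)
  qed
  then show ?thesis unfolding distribution_labeling_def by (metis surj_pair)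
qed

end

theory Submission
  imports Defs
begin

text \<open>A pair \<open>u \<rightarrow> w\<close> is covered as soon as the first vertex \<open>v\<close> of the order lying on some path
  from \<open>u\<close> to \<open>w\<close> has been processed. If a vertex on a path from \<open>u\<close> to \<open>v\<close>, or from \<open>v\<close>
  to \<open>w\<close>, were pruned, the common label causing this would be an earlier vertex on a path from
  \<open>u\<close> to \<open>w\<close>; so both searches from \<open>v\<close> get through and \<open>v\<close> becomes a common label.\<close>

text \<open>The labels of discovered vertices still in the queue are the original ones \<open>L0\<close>. This
  matters because \<open>H\<close> may contain \<open>s\<close>.\<close>

definition bfs_inv ::
  "('a \<times> 'a) set \<Rightarrow> 'a \<Rightarrow> 'a set \<Rightarrow> 'a labels \<Rightarrow> 'a list \<times> 'a set \<times> 'a labels \<Rightarrow> bool"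
where
  "bfs_inv R s H L0 = (\<lambda>(q, D, L).
     distinct q \<and> set q \<subseteq> D \<and> s \<in> D \<and> D \<subseteq> R\<^sup>* `` {s} \<and>
     (\<forall>x. x \<notin> D \<or> x \<in> set q \<longrightarrow> L x = L0 x) \<and>
     (\<forall>x \<in> D - set q. L0 x \<inter> H \<noteq> {} \<and> L x = L0 x \<or>
        L x = insert s (L0 x) \<and> R `` {x} \<subseteq> D))"

lemma bfs_inv_step:
  assumes "bfs_step R s H S S'" "bfs_inv R s H L0 S"
  shows "bfs_inv R s H L0 S'"
  using assms
proof cases
  case (prune L u q D)
  with assms(2) show ?thesis by (auto simp: bfs_inv_def)
next
  case (expand L u ws D q)
  let ?D = "D \<union> set ws" and ?L = "L(u := insert s (L u))"
  from assms(2) have inv: "distinct (u # q)" "set (u # q) \<subseteq> D" "s \<in> D" "D \<subseteq> R\<^sup>* `` {s}"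
    and same: "\<And>x. x \<notin> D \<or> x \<in> set (u # q) \<Longrightarrow> L x = L0 x"
    and explored: "\<And>x. x \<in> D - set (u # q) \<Longrightarrow> L0 x \<inter> H \<noteq> {} \<and> L x = L0 x \<or>
        L x = insert s (L0 x) \<and> R `` {x} \<subseteq> D"
    by (simp_all add: bfs_inv_def expand)
  have ws: "set ws \<inter> D = {}" "R `` {u} \<subseteq> ?D" using expand(5) by auto
  have "set ws \<subseteq> R `` {u}" using expand(5) by blast
  moreover have "(s, u) \<in> R\<^sup>*" using inv by auto
  ultimately have "set ws \<subseteq> R\<^sup>* `` {s}" by (auto intro: rtrancl_into_rtrancl)
  moreover have "distinct (q @ ws)" using inv expand(4) ws by auto
  moreover have "?L x = L0 x" if "x \<notin> ?D \<or> x \<in> set (q @ ws)" for x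
  proof -
    \<comment> \<open>Only the label of \<open>u\<close> changes. The vertex \<open>u\<close> lies
      in \<open>D\<close>, occurs once in the old queue and is not in \<open>ws\<close>; a vertex of
      \<open>ws\<close> was undiscovered and so unlabelled by this search.\<close>
    from that inv ws have "x \<noteq> u" "x \<notin> D \<or> x \<in> set (u # q)" by auto
    with same show ?thesis by simp
  qed
  moreover have "L0 x \<inter> H \<noteq> {} \<and> ?L x = L0 x \<or> ?L x = insert s (L0 x) \<and> R `` {x} \<subseteq> ?D"
    if "x \<in> ?D - set (q @ ws)" for x
  proof (cases "x = u")
    case True
    \<comment> \<open>\<open>u\<close> was still queued, so the label just extended is
      \<open>L0 u\<close>.\<close>
    with same[of u] ws show ?thesis by simp
  next
    case False
    with that have "x \<in> D - set (u # q)" by auto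
    with explored[OF this] False show ?thesis by auto
  qed
  moreover have "set (q @ ws) \<subseteq> ?D" using inv by auto
  ultimately show ?thesis
    using inv(3,4) unfolding expand(2) bfs_inv_def prod.case by blast
qed

text \<open>With the queue empty, each vertex of \<open>D\<close> was pruned or expanded. Later
  arguments use only this, so the enqueueing order never enters.\<close>

lemma bfs_inv_pruned_bfs:
  assumes "pruned_bfs R s H L L'"
  obtains D where "bfs_inv R s H L ([], D, L')"
proof -
  obtain D where "(bfs_step R s H)\<^sup>*\<^sup>* ([s], {s}, L) ([], D, L')"
    using assms by (auto simp: pruned_bfs_def)
  then have "bfs_inv R s H L ([], D, L')"
  proof induction
    case base
    show ?case by (simp add: bfs_inv_def)
  next
    case step
    then show ?case by (blast intro: bfs_inv_step)
  qed
  then show ?thesis by (rule that)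
qed

lemma pruned_bfs_mono:
  assumes "pruned_bfs R s H L L'"
  shows "L x \<subseteq> L' x"
  using assms by (rule bfs_inv_pruned_bfs) (auto simp: bfs_inv_def)

lemma pruned_bfs_sound:
  assumes "pruned_bfs R s H L L'" "h \<in> L' x"
  shows "h \<in> L x \<or> h = s \<and> (s, x) \<in> R\<^sup>*"
proof -
  obtain D where "bfs_inv R s H L ([], D, L')"
    using assms(1) by (rule bfs_inv_pruned_bfs)
  then show ?thesis
    using assms(2) by (cases "x \<in> D") (auto simp: bfs_inv_def)
qed

text \<open>Every vertex on a path from \<open>s\<close> to \<open>x\<close> passes the test, so
  once discovered it is expanded and discovers its successor on the path.\<close>

lemma pruned_bfs_reaches:
  assumes bfs: "pruned_bfs R s H L L'" and "(s, x) \<in> R\<^sup>*"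
    and unpruned: "\<And>y. (s, y) \<in> R\<^sup>* \<Longrightarrow> (y, x) \<in> R\<^sup>* \<Longrightarrow> L y \<inter> H = {}"
  shows "s \<in> L' x"
proof -
  obtain D where inv: "bfs_inv R s H L ([], D, L')"
    using bfs by (rule bfs_inv_pruned_bfs)
  have "x \<in> D"
    \<comment> \<open>\<open>unpruned\<close> mentions the endpoint, so it joins the induction: what
      reaches \<open>y\<close> also reaches \<open>z\<close>.\<close>
    using \<open>(s, x) \<in> R\<^sup>*\<close> unpruned
  proof induction
    case base
    show ?case using inv by (simp add: bfs_inv_def)
  next
    case (step y z)
    then have "y \<in> D" "L y \<inter> H = {}" by (meson rtrancl.rtrancl_into_rtrancl r_into_rtrancl)+
    then show ?case using inv \<open>(y, z) \<in> R\<close> by (auto simp: bfs_inv_def)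
  qed
  with inv unpruned[OF \<open>(s, x) \<in> R\<^sup>*\<close>] show ?thesis by (auto simp: bfs_inv_def)
qed

text \<open>\<open>P\<close> stands for the vertices processed so far. Membership in
  \<open>P\<close> is what turns a pruning label into an earlier vertex on the path.\<close>

definition sound_labels ::
  "('a \<times> 'a) set \<Rightarrow> 'a set \<Rightarrow> 'a labels \<Rightarrow> 'a labels \<Rightarrow> bool" where
  "sound_labels E P Lout Lin \<longleftrightarrow>
    (\<forall>x. \<forall>h \<in> Lout x. h \<in> P \<and> (x, h) \<in> E\<^sup>*) \<and>
    (\<forall>x. \<forall>h \<in> Lin x. h \<in> P \<and> (h, x) \<in> E\<^sup>*)"

text \<open>Completeness relative to \<open>P\<close>: only pairs joined by a path through
  \<open>P\<close> must share a label.\<close>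

definition covering_labels ::
  "('a \<times> 'a) set \<Rightarrow> 'a set \<Rightarrow> 'a labels \<Rightarrow> 'a labels \<Rightarrow> bool" where
  "covering_labels E P Lout Lin \<longleftrightarrow>
    (\<forall>u w. \<forall>h \<in> P. (u, h) \<in> E\<^sup>* \<longrightarrow> (h, w) \<in> E\<^sup>* \<longrightarrow> Lout u \<inter> Lin w \<noteq> {})"

lemma sound_labels_step:
  assumes "pruned_bfs (E\<inverse>) v (Lin v) Lout Lout'"
    and "pruned_bfs E v (Lout' v) Lin Lin'"
    and "sound_labels E P Lout Lin"
  shows "sound_labels E (insert v P) Lout' Lin'"
  using pruned_bfs_sound[OF assms(1)] pruned_bfs_sound[OF assms(2)] assms(3)
  unfolding sound_labels_def rtrancl_converse by blast

lemma covering_labels_step: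
  assumes bwd: "pruned_bfs (E\<inverse>) v (Lin v) Lout Lout'"
    and fwd: "pruned_bfs E v (Lout' v) Lin Lin'"
    and sound: "sound_labels E P Lout Lin"
    and cover: "covering_labels E P Lout Lin"
  shows "covering_labels E (insert v P) Lout' Lin'"
  unfolding covering_labels_def
proof (intro allI ballI impI)
  fix u w h
  assume h: "h \<in> insert v P" "(u, h) \<in> E\<^sup>*" "(h, w) \<in> E\<^sup>*"
  show "Lout' u \<inter> Lin' w \<noteq> {}"
  proof (cases "\<exists>p \<in> P. (u, p) \<in> E\<^sup>* \<and> (p, w) \<in> E\<^sup>*")
    case True
    then have "Lout u \<inter> Lin w \<noteq> {}"
      using cover unfolding covering_labels_def by blast
    then show ?thesis
      using pruned_bfs_mono[OF bwd, of u] pruned_bfs_mono[OF fwd, of w] by blast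
  next
    case False
    \<comment> \<open>No vertex of \<open>P\<close> lies between \<open>u\<close> and
      \<open>w\<close>, so \<open>h\<close> is \<open>v\<close>.\<close>
    with h have uv: "(u, v) \<in> E\<^sup>*" and vw: "(v, w) \<in> E\<^sup>*" by auto
    \<comment> \<open>\<open>Lout' v\<close> may already contain \<open>v\<close>, so only
      reachability is taken from it; membership in \<open>P\<close> comes from \<open>Lin\<close>,
      which is the old labeling in both tests.\<close>
    have sound_out': "(x, p) \<in> E\<^sup>*" if "p \<in> Lout' x" for x p
      using sound_labels_step[OF bwd fwd sound] that by (auto simp: sound_labels_def)
    have sound_in: "p \<in> P \<and> (p, x) \<in> E\<^sup>*" if "p \<in> Lin x" for x p
      using sound that by (auto simp: sound_labels_def)
    have "v \<in> Lout' u"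
    proof (rule pruned_bfs_reaches[OF bwd])
      show "(v, u) \<in> (E\<inverse>)\<^sup>*" using uv by (simp add: rtrancl_converse)
    next
      fix y
      assume "(y, u) \<in> (E\<inverse>)\<^sup>*"
      then have uy: "(u, y) \<in> E\<^sup>*" by (simp add: rtrancl_converse)
      \<comment> \<open>Such a \<open>p\<close> lies on a path \<open>u\<close>, \<open>y\<close>,
        \<open>p\<close>, \<open>v\<close>, \<open>w\<close>.\<close>
      have False if "p \<in> Lout y" "p \<in> Lin v" for p
      proof -
        have "(y, p) \<in> E\<^sup>*" using that(1) sound by (auto simp: sound_labels_def)
        with uy have "(u, p) \<in> E\<^sup>*" by (rule rtrancl_trans)
        moreover have "(p, w) \<in> E\<^sup>*"
          using sound_in[OF that(2)] vw by (meson rtrancl_trans)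
        ultimately show False using sound_in[OF that(2)] False by blast
      qed
      then show "Lout y \<inter> Lin v = {}" by blast
    qed
    moreover have "v \<in> Lin' w"
    proof (rule pruned_bfs_reaches[OF fwd vw])
      fix y
      assume yw: "(y, w) \<in> E\<^sup>*"
      \<comment> \<open>Here the path is \<open>u\<close>, \<open>v\<close>, \<open>p\<close>,
        \<open>y\<close>, \<open>w\<close>.\<close>
      have False if "p \<in> Lin y" "p \<in> Lout' v" for p
      proof -
        have "(u, p) \<in> E\<^sup>*" using uv sound_out'[OF that(2)] by (rule rtrancl_trans)
        moreover have "(p, w) \<in> E\<^sup>*"
          using sound_in[OF that(1)] yw by (meson rtrancl_trans)
        ultimately show False using sound_in[OF that(1)] False by blast
      qed
      then show "Lin y \<inter> Lout' v = {}" by blast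
    qed
    ultimately show ?thesis by blast
  qed
qed

text \<open>\<open>P\<close> is arbitrary because, after \<open>v\<close>, the rest of the run
  starts from \<open>insert v P\<close>.\<close>

lemma dl_run_sound_covering:
  assumes "dl_run E vs S S'"
    and "sound_labels E P (fst S) (snd S)" "covering_labels E P (fst S) (snd S)"
  shows "sound_labels E (set vs \<union> P) (fst S') (snd S') \<and>
    covering_labels E (set vs \<union> P) (fst S') (snd S')"
  using assms
proof (induction arbitrary: P)
  case (Nil S)
  then show ?case by simp
next
  case (Cons v Lin Lout Lout' Lin' vs S)
  have "sound_labels E (insert v P) Lout' Lin'" "covering_labels E (insert v P) Lout' Lin'"
    using Cons.prems sound_labels_step[OF Cons.hyps(1,2)] covering_labels_step[OF Cons.hyps(1,2)]
    by simp_all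
  with Cons.IH[of "insert v P"] show ?case by simp
qed

theorem theorem3:
  fixes V :: "'a set" and E :: "('a \<times> 'a) set" and vs :: "'a list"
    and Lout Lin :: "'a \<Rightarrow> 'a set"
  assumes "finite_dag V E"
    and "distinct vs" and "set vs = V"
    and "distribution_labeling E vs Lout Lin"
  shows "\<forall>u\<in>V. \<forall>v\<in>V. (u, v) \<in> E\<^sup>* \<longleftrightarrow> Lout u \<inter> Lin v \<noteq> {}"
proof -
  have "dl_run E vs (\<lambda>_. {}, \<lambda>_. {}) (Lout, Lin)"
    using assms(4) by (simp add: distribution_labeling_def)
  \<comment> \<open>Empty labels are sound and covering for the empty set.\<close>
  from dl_run_sound_covering[OF this, of "{}"]
  have "sound_labels E V Lout Lin" and cover: "covering_labels E V Lout Lin"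
    using assms(3) by (simp_all add: sound_labels_def covering_labels_def)
  then have "(u, v) \<in> E\<^sup>*" if "Lout u \<inter> Lin v \<noteq> {}" for u v
    using that unfolding sound_labels_def by (meson disjoint_iff rtrancl_trans)
  \<comment> \<open>The covering vertex is \<open>u\<close> itself, via the path of length
    0.\<close>
  moreover have "Lout u \<inter> Lin v \<noteq> {}" if "u \<in> V" "(u, v) \<in> E\<^sup>*" for u v
    using cover that unfolding covering_labels_def by blast
  ultimately show ?thesis by blast
qed

end
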